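(* The three-stage two-parameter EERK3-2 method with $c_2=\frac12$ and $c_3=\frac7{10}$, where $g_h$ is Lipschitz continuous with constant $\ell_g>0$ and $\kappa\ge2\ell_g$, preserves the energy dissipation law at all stages: for every $\tau>0$, $n\ge1$ and $1\le j\le3$, $$E[U^{n,j+1}]-E[U^{n,1}]\le-\frac1\tau\sum_{k=1}^{j}\Big\langle\delta_\tau U^{n,k+1},\sum_{\ell=1}^{k}d^{(3,2)}_{k\ell}(\tfrac12,\tfrac7{10},-\tau L_\kappa)\,\delta_\tau U^{n,\ell+1}\Big\rangle\le0,$$ where $\delta_\tau U^{n,k+1}:=U^{n,k+1}-U^{n,k}$ and $D^{(3,2)}(c_2,c_3,z)=(d^{(3,2)}_{k\ell}(c_2,c_3,z))$ is the differentiation matrix of the method.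
   Context: $\langle u,v\rangle=v^Tu$ and $\|v\|=\sqrt{\langle v,v\rangle}$ on $\mathbb{R}^M$; Lipschitz is with respect to $\|\cdot\|$. $L_h\in\mathbb{R}^{M\times M}$ is symmetric positive definite. $G_h\ge0$ is a non-negative Lyapunov function with $g_h(v)=-\frac{\delta}{\delta v}G_h(v)$, i.e. the gradient of the scalar function $v\mapsto\langle G_h(v),1\rangle$ is $-g_h(v)$, where $1$ is the all-ones vector. The energy is $E[v]=\frac12\langle v,L_hv\rangle+\langle G_h(v),1\rangle$. Stabilized operators: $L_\kappa:=L_h+\kappa I$, $g_\kappa(u):=g_h(u)+\kappa u$. $\varphi_0(z)=e^z$, $\varphi_{k+1}(z)=(\varphi_k(z)-1/k!)/z$ (entire functions, extended continuously to $z=0$). For a function $f$, $f(-\tau L_\kappa)$ is the matrix function defined through the spectrum of the symmetric matrix $-\tau L_\kappa$. EERK3-2 method (abscissas $c_2\ne\frac23$, $c_3\ne c_2$, $c_3\neq\frac23$; $\gamma:=\frac{(3c_3-2)c_3}{(2-3c_2)c_2}$): $U^{n,1}=u_h^{n-1}$, $U^{n,i+1}=U^{n,1}+\sum_{j=1}^{i}a_{i+1,j}(-\tau L_\kappa)[\tau g_\kappa(U^{n,j})-\tau L_\kappa U^{n,1}]$ for $1\le i\le3$, $u_h^n=U^{n,4}$, with $a_{21}(z)=c_2\varphi_1(c_2z)$; $a_{32}(z)=\gamma c_2\varphi_2(c_2z)+\frac{c_3^2}{c_2}\varphi_2(c_3z)$; $a_{31}(z)=c_3\varphi_1(c_3z)-a_{32}(z)$;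 $a_{42}(z)=\frac{\gamma}{\gamma c_2+c_3}\varphi_2(z)$; $a_{43}(z)=\frac1{\gamma c_2+c_3}\varphi_2(z)$; $a_{41}(z)=\varphi_1(z)-a_{42}(z)-a_{43}(z)$. Differentiation matrix ($s=3$): $\underline a_{i+1,i}:=a_{i+1,i}$, $\underline a_{i+1,j}:=a_{i+1,j}-a_{i,j}$ for $1\le j\le i-1$; $\underline\theta_{k,k}:=1/\underline a_{k+1,k}$, $\underline\theta_{k,j}:=-\sum_{\ell=j+1}^{k}\underline\theta_{k,\ell}\,\underline a_{\ell+1,j}/\underline a_{j+1,j}$ for $1\le j\le k-1$; $d_{k\ell}(z):=\underline\theta_{k\ell}(z)+\frac z2(2-\delta_{k\ell})$ for $1\le\ell\le k\le s$ ($\delta_{k\ell}$ the Kronecker delta) and $d_{k\ell}:=0$ for $\ell>k$. These $d_{k\ell}$ are denoted $d^{(3,2)}_{k\ell}(c_2,c_3,z)$. *)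

theory Defs
  imports "HOL-Analysis.Analysis"
begin

definition sym_pos_def :: "real^'n^'n \<Rightarrow> bool" where
  "sym_pos_def A \<longleftrightarrow> transpose A = A \<and> (\<forall>v. v \<noteq> 0 \<longrightarrow> v \<bullet> (A *v v) > 0)"

definition diag_matrix :: "('n \<Rightarrow> real) \<Rightarrow> real^'n^'n" where
  "diag_matrix d = (\<chi> i j. if i = j then d i else 0)"

(* f(A) through the spectral decomposition A = P diag(d) P^T. It does not depend on the chosen
   decomposition, and one exists exactly when A is symmetric; other A give an unspecified value. *)
definition mat_fun :: "(real \<Rightarrow> real) \<Rightarrow> real^'n^'n \<Rightarrow> real^'n^'n" where
  "mat_fun f A = (THE B. \<exists>P d. orthogonal_matrix P \<and>
      A = P ** diag_matrix d ** transpose P \<and>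
      B = P ** diag_matrix (\<lambda>i. f (d i)) ** transpose P)"

(* Real arguments suffice, since these are evaluated only on spectra of symmetric matrices.
   1/(k+1)! is the limit at 0, i.e. the value of the continuous extension. *)
fun phi :: "nat \<Rightarrow> real \<Rightarrow> real" where
  "phi 0 z = exp z"
| "phi (Suc k) z = (if z = 0 then 1 / fact (Suc k) else (phi k z - 1 / fact k) / z)"

(* The tableau a_{ij}(z) is indexed as in the method: i = 2..s+1 and j = 1..i-1. *)
definition eerk32 :: "real \<Rightarrow> real \<Rightarrow> nat \<Rightarrow> nat \<Rightarrow> real \<Rightarrow> real" where
  "eerk32 c2 c3 i j z =
    (let \<gamma> = (3 * c3 - 2) * c3 / ((2 - 3 * c2) * c2);
         a21 = c2 * phi 1 (c2 * z);
         a32 = \<gamma> * c2 * phi 2 (c2 * z) + c3\<^sup>2 / c2 * phi 2 (c3 * z);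
         a31 = c3 * phi 1 (c3 * z) - a32;
         a42 = \<gamma> / (\<gamma> * c2 + c3) * phi 2 z;
         a43 = 1 / (\<gamma> * c2 + c3) * phi 2 z;
         a41 = phi 1 z - a42 - a43
     in if (i, j) = (2, 1) then a21
        else if (i, j) = (3, 1) then a31
        else if (i, j) = (3, 2) then a32
        else if (i, j) = (4, 1) then a41
        else if (i, j) = (4, 2) then a42
        else if (i, j) = (4, 3) then a43
        else 0)"

definition diff_coeff :: "(nat \<Rightarrow> nat \<Rightarrow> real \<Rightarrow> real) \<Rightarrow> nat \<Rightarrow> nat \<Rightarrow> real \<Rightarrow> real" where
  "diff_coeff a i j z = (if i = j + 1 then a i j z else a i j z - a (i - 1) j z)"

(* For fixed k the recursion runs downwards from j = k. *)
function theta :: "(nat \<Rightarrow> nat \<Rightarrow> real \<Rightarrow> real) \<Rightarrow> nat \<Rightarrow> nat \<Rightarrow> real \<Rightarrow> real" where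
  "theta a k j z =
    (if j = k then 1 / diff_coeff a (k + 1) k z
     else if j < k then
       - (\<Sum>l = j + 1..k. theta a k l z * diff_coeff a (l + 1) j z / diff_coeff a (j + 1) j z)
     else 0)"
  by pat_completeness auto
termination
  by (relation "Wellfounded.measure (\<lambda>(a, k, j, z). k - j)") auto

declare theta.simps [simp del]

definition diff_matrix :: "(nat \<Rightarrow> nat \<Rightarrow> real \<Rightarrow> real) \<Rightarrow> nat \<Rightarrow> nat \<Rightarrow> real \<Rightarrow> real" where
  "diff_matrix a k l z =
    (if l \<le> k then theta a k l z + z / 2 * (2 - (if k = l then 1 else 0)) else 0)"

(* In the Lyapunov term, 1 is the all-ones vector. *)
definition energy :: "real^'n^'n \<Rightarrow> (real^'n \<Rightarrow> real^'n) \<Rightarrow> real^'n \<Rightarrow> real" where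
  "energy L G v = 1 / 2 * (v \<bullet> (L *v v)) + G v \<bullet> 1"

definition L_stab :: "real^'n^'n \<Rightarrow> real \<Rightarrow> real^'n^'n" where
  "L_stab L \<kappa> = L + \<kappa> *\<^sub>R mat 1"

definition g_stab :: "(real^'n \<Rightarrow> real^'n) \<Rightarrow> real \<Rightarrow> real^'n \<Rightarrow> real^'n" where
  "g_stab g \<kappa> v = g v + \<kappa> *\<^sub>R v"

(* u n is the numerical solution at time level n, and U n i is the i-th stage of the step from
   level n - 1 to level n. The method is explicit, so u 0 determines u and all stages. *)
definition eerk_solution ::
  "nat \<Rightarrow> (nat \<Rightarrow> nat \<Rightarrow> real \<Rightarrow> real) \<Rightarrow> real^'n^'n \<Rightarrow> (real^'n \<Rightarrow> real^'n) \<Rightarrow> real \<Rightarrow> real \<Rightarrow>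
    (nat \<Rightarrow> real^'n) \<Rightarrow> (nat \<Rightarrow> nat \<Rightarrow> real^'n) \<Rightarrow> bool" where
  "eerk_solution s a L g \<kappa> \<tau> u U \<longleftrightarrow>
    (\<forall>n\<ge>1. U n 1 = u (n - 1) \<and>
      (\<forall>i\<in>{1..s}. U n (i + 1) = U n 1 +
        (\<Sum>j = 1..i. mat_fun (a (i + 1) j) (- (\<tau> *\<^sub>R L_stab L \<kappa>)) *v
          (\<tau> *\<^sub>R g_stab g \<kappa> (U n j) - \<tau> *\<^sub>R (L_stab L \<kappa> *v U n 1)))) \<and>
      u n = U n (s + 1))"

definition stage_diff :: "(nat \<Rightarrow> nat \<Rightarrow> real^'n) \<Rightarrow> nat \<Rightarrow> nat \<Rightarrow> real^'n" where
  "stage_diff U n i = U n i - U n (i - 1)"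

end

(* Diagonalizing L reduces the statement to the eigenvalues z < 0 of - tau L_kappa. Since theta inverts the
   triangular array of the coefficients diff_coeff, the stage differences turn into
     sum_l d_kl delta_(l+1) = tau (g_kappa(U_k) - L_kappa (U_k + U_(k+1)) / 2),
   and the mean value theorem with the Lipschitz bound lg <= kappa / 2 bounds the energy increment of each
   stage by - <delta_(k+1), sum_l d_kl delta_(l+1)> / tau.

   For the sign, write delta = A(z) r with A the triangular array. The quadratic form of the differentiation
   matrix becomes r^T A(z) r + (z/2) (sum_k delta_k)^2, which involves no reciprocals. With x = - z, the
   phi-functions are Laplace transforms of piecewise linear densities, so that this form equals x times the
   Laplace transform at x of a function h of s >= 0: the primitive of the density of r^T A r, minus half the
   self-convolution of the density of sum_k delta_k. For c2 = 1/2, c3 = 7/10 the function h is a cubic on each of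
   four intervals and constant after s = 2, and all its Bernstein coefficients are positive semidefinite
   quadratic forms in r. *)
theory Submission
  imports Defs
begin

section \<open>Spectral theorem for real symmetric matrices\<close>

text \<open>A maximizer of the Rayleigh quotient on the unit sphere of \<open>S\<close> is an
  eigenvector, and its orthogonal complement in \<open>S\<close> is again invariant. Stating this
  for invariant subspaces lets the induction descend to that complement.\<close>

lemma symmetric_matrix_eigenbasis:
  fixes A :: "real^'n^'n"
  assumes sym: "transpose A = A" and S: "subspace S" and inv: "\<And>v. v \<in> S \<Longrightarrow> A *v v \<in> S"
  shows "\<exists>B. B \<subseteq> S \<and> pairwise orthogonal B \<and> (\<forall>b\<in>B. norm b = 1) \<and> card B = dim S \<and> finite B \<and>
    (\<forall>b\<in>B. \<exists>c. A *v b = c *\<^sub>R b)"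
  using S inv
proof (induction "dim S" arbitrary: S rule: less_induct)
  case less
  have self: "v \<bullet> (A *v w) = (A *v v) \<bullet> w" for v w
    by (metis dot_lmul_matrix sym transpose_matrix_vector)
  show ?case
  proof (cases "dim S = 0")
    case True
    then show ?thesis by (intro exI[of _ "{}"]) auto
  next
    case False
    then obtain u where u: "u \<in> S" "u \<noteq> 0"
      by (metis dim_eq_0 singletonI subsetI)
    let ?K = "sphere 0 1 \<inter> S"
    have "compact ?K"
      using closed_subspace[OF less.prems(1)] by (simp add: compact_Int_closed)
    moreover have "u /\<^sub>R norm u \<in> ?K"
      using u less.prems(1) by (auto simp: subspace_scale)
    then have "?K \<noteq> {}" by blast
    moreover have "continuous_on ?K (\<lambda>v. v \<bullet> (A *v v))"
      by (intro continuous_on_inner continuous_on_id matrix_vector_mult_linear_continuous_on)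
    ultimately obtain v where v: "v \<in> ?K" and vmax: "\<And>w. w \<in> ?K \<Longrightarrow> w \<bullet> (A *v w) \<le> v \<bullet> (A *v v)"
      using continuous_attains_sup[of ?K "\<lambda>v. v \<bullet> (A *v v)"] by metis
    define c where "c = v \<bullet> (A *v v)"
    \<comment> \<open>By maximality \<open>g\<close> is nonnegative on \<open>S\<close>, and it
      vanishes at \<open>v\<close>. So \<open>v\<close> minimizes \<open>g\<close>, and the
      eigenvalue equation is the first-order condition.\<close>
    define g where "g w = c * (w \<bullet> w) - w \<bullet> (A *v w)" for w
    have g_nonneg: "0 \<le> g w" if w: "w \<in> S" for w
    proof (cases "w = 0")
      case True
      then show ?thesis by (simp add: g_def)
    next
      case False
      have "w /\<^sub>R norm w \<in> ?K"
        using w False less.prems(1) by (auto simp: subspace_scale)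
      from vmax[OF this] have "w \<bullet> (A *v w) / (norm w)\<^sup>2 \<le> c"
        by (simp add: c_def matrix_vector_mult_scaleR power2_eq_square divide_inverse mult_ac)
      then show ?thesis
        using False by (simp add: g_def dot_square_norm pos_divide_le_eq)
    qed
    have vS: "v \<in> S" "v \<bullet> v = 1" using v by (auto simp: dot_square_norm)
    \<comment> \<open>The eigenvector residual, which is half the gradient of \<open>g\<close> at
      \<open>v\<close>.\<close>
    define b where "b = c *\<^sub>R v - A *v v"
    have bS: "b \<in> S"
      unfolding b_def using vS less.prems by (auto intro!: subspace_diff subspace_scale)
    have g_line: "g (v + t *\<^sub>R b) = 2 * t * (b \<bullet> b) + t\<^sup>2 * g b" for t
    proof -
      have *: "b \<bullet> (A *v v) = (A *v b) \<bullet> v" "v \<bullet> (A *v b) = (A *v b) \<bullet> v"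
        using self inner_commute by metis+
      have "b \<bullet> b = c * (b \<bullet> v) - (A *v b) \<bullet> v"
        by (subst (2) b_def) (simp add: inner_diff_right *)
      moreover have "g (v + t *\<^sub>R b) = 2 * t * (c * (b \<bullet> v) - (A *v b) \<bullet> v) + t\<^sup>2 * g b"
        by (simp add: g_def matrix_vector_right_distrib matrix_vector_mult_scaleR inner_add_left
            inner_add_right * vS c_def[symmetric] power2_eq_square algebra_simps inner_commute[of v b])
      ultimately show ?thesis by simp
    qed
    have "b \<bullet> b = 0"
    proof (rule ccontr)
      assume "b \<bullet> b \<noteq> 0"
      then have bpos: "0 < b \<bullet> b" by simp
      have gb: "0 \<le> g b" by (rule g_nonneg[OF bS])
      \<comment> \<open>A negative step so short that the linear term of \<open>g_line\<close>
        dominates and would make \<open>g\<close> negative. The \<open>+ 1\<close> keeps the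
        denominator positive when \<open>g b = 0\<close>.\<close>
      define t where "t = - (b \<bullet> b) / (g b + 1)"
      have "t * (g b + 1) = - (b \<bullet> b)" "t < 0"
        using gb bpos by (simp_all add: t_def divide_neg_pos)
      moreover have "0 \<le> t * (2 * (b \<bullet> b) + t * g b)"
      proof -
        have "0 \<le> g (v + t *\<^sub>R b)"
          using vS bS less.prems(1) by (intro g_nonneg subspace_add subspace_scale)
        then show ?thesis
          unfolding g_line by (simp only: power2_eq_square distrib_left mult_ac)
      qed
      ultimately have "2 * (b \<bullet> b) + t * g b \<le> 0"
        by (simp add: zero_le_mult_iff)
      then have "b \<bullet> b \<le> t"
        using \<open>t * (g b + 1) = - (b \<bullet> b)\<close> by (simp add: algebra_simps)
      then show False using \<open>t < 0\<close> bpos by simp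
    qed
    then have eig: "A *v v = c *\<^sub>R v" by (simp add: b_def)
    define S' where "S' = {w \<in> S. v \<bullet> w = 0}"
    have S': "subspace S'"
      using less.prems(1) by (auto simp: S'_def subspace_def inner_add_right)
    have inv': "A *v w \<in> S'" if "w \<in> S'" for w
      using that less.prems(2) self[of v w] eig by (auto simp: S'_def)
    have "span (insert v S') = S"
    proof
      show "span (insert v S') \<subseteq> S"
        using vS less.prems(1) by (intro span_minimal) (auto simp: S'_def)
      show "S \<subseteq> span (insert v S')"
      proof
        fix w assume "w \<in> S"
        then have "w - (v \<bullet> w) *\<^sub>R v \<in> S'"
          using vS less.prems(1) by (auto simp: S'_def inner_diff_right intro!: subspace_diff subspace_scale)
        then show "w \<in> span (insert v S')"
          using span_breakdown_eq span_base by blast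
      qed
    qed
    moreover have "v \<notin> span S'"
      using S' vS by (simp add: span_eq_iff[THEN iffD2] S'_def)
    ultimately have dim: "dim S = Suc (dim S')"
      by (metis dim_insert dim_span Suc_eq_plus1)
    from less.hyps[OF _ S' inv'] dim obtain B where
      B: "B \<subseteq> S'" "pairwise orthogonal B" "\<forall>b\<in>B. norm b = 1" "card B = dim S'" "finite B"
         "\<forall>b\<in>B. \<exists>c. A *v b = c *\<^sub>R b"
      by auto
    have "v \<notin> B" using B(1) vS by (auto simp: S'_def)
    then show ?thesis
      using B vS eig dim
      by (intro exI[of _ "insert v B"])
        (auto simp: S'_def pairwise_insert orthogonal_def inner_commute norm_eq_1)
  qed
qed

section \<open>Diagonalization and matrix functions\<close>

lemma diag_matrix_mult_left: "(diag_matrix d ** M) $ i $ j = d i * M $ i $ j"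
proof -
  have "(diag_matrix d ** M) $ i $ j = (\<Sum>k\<in>UNIV. (if i = k then d i else 0) * M $ k $ j)"
    by (simp only: matrix_matrix_mult_def diag_matrix_def vec_lambda_beta)
  also have "\<dots> = (\<Sum>k\<in>UNIV. if i = k then d i * M $ k $ j else 0)"
    by (rule sum.cong[OF refl]) simp
  also have "\<dots> = d i * M $ i $ j"
    using sum.delta'[of UNIV i "\<lambda>k. d i * M $ k $ j"]
    by (simp only: finite_class.finite_UNIV if_True UNIV_I)
  finally show ?thesis .
qed

lemma diag_matrix_mult_right: "(M ** diag_matrix d) $ i $ j = M $ i $ j * d j"
proof -
  have "(M ** diag_matrix d) $ i $ j = (\<Sum>k\<in>UNIV. M $ i $ k * (if k = j then d k else 0))"
    by (simp only: matrix_matrix_mult_def diag_matrix_def vec_lambda_beta)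
  also have "\<dots> = (\<Sum>k\<in>UNIV. if k = j then M $ i $ k * d k else 0)"
    by (rule sum.cong[OF refl]) simp
  also have "\<dots> = M $ i $ j * d j"
    using sum.delta[of UNIV j "\<lambda>k. M $ i $ k * d k"]
    by (simp only: finite_class.finite_UNIV if_True UNIV_I)
  finally show ?thesis .
qed

lemma diag_matrix_mult_vec: "(diag_matrix d *v v) $ i = d i * v $ i"
proof -
  have "(diag_matrix d *v v) $ i = (\<Sum>k\<in>UNIV. if i = k then d i * v $ k else 0)"
    unfolding matrix_vector_mult_def diag_matrix_def vec_lambda_beta by (rule sum.cong) auto
  then show ?thesis by simp
qed

lemma symmetric_matrix_diagonalizable:
  fixes A :: "real^'n^'n"
  assumes "transpose A = A"
  obtains P d where "orthogonal_matrix P" "A = P ** diag_matrix d ** transpose P"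
proof -
  obtain B where B: "pairwise orthogonal B" "\<forall>b\<in>B. norm b = 1" "card B = CARD('n)" "finite B"
      "\<forall>b\<in>B. \<exists>c. A *v b = c *\<^sub>R b"
    using symmetric_matrix_eigenbasis[OF assms subspace_UNIV] by auto
  obtain e :: "'n \<Rightarrow> real^'n" where e: "bij_betw e UNIV B"
    using finite_same_card_bij[of "UNIV :: 'n set" B] B(3,4) by auto
  define P :: "real^'n^'n" where "P = (\<chi> i j. e j $ i)"
  have col: "column j P = e j" for j
    by (simp add: column_def P_def)
  have eB: "e j \<in> B" for j using e by (auto simp: bij_betw_def)
  have P: "orthogonal_matrix P"
    unfolding orthogonal_matrix_orthonormal_columns col
  proof (intro conjI allI impI)
    show "norm (e i) = 1" for i
      using B(2) eB by blast
    fix i j :: 'n assume "i \<noteq> j"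
    then have "e i \<noteq> e j"
      using e by (auto simp: bij_betw_def dest: injD)
    then show "orthogonal (e i) (e j)"
      using B(1) eB by (auto simp: pairwise_def)
  qed
  have "\<forall>j. \<exists>c. A *v e j = c *\<^sub>R e j"
    using B(5) eB by blast
  then obtain d where d: "\<And>j. A *v e j = d j *\<^sub>R e j"
    by metis
  have "A ** P = P ** diag_matrix d"
  proof -
    have "(A ** P) $ i $ j = (A *v e j) $ i" for i j
      by (simp add: matrix_matrix_mult_def matrix_vector_mult_def P_def)
    moreover have "(P ** diag_matrix d) $ i $ j = d j * e j $ i" for i j
      by (simp add: diag_matrix_mult_right P_def)
    ultimately show ?thesis by (simp add: vec_eq_iff d)
  qed
  then have "P ** diag_matrix d ** transpose P = A ** (P ** transpose P)"
    by (simp add: matrix_mul_assoc)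
  also have "\<dots> = A"
    using P by (simp add: orthogonal_matrix_def)
  finally have "A = P ** diag_matrix d ** transpose P" ..
  with P show thesis by (rule that)
qed

text \<open>The description in \<open>mat_fun\<close> determines its value: for two decompositions,
  \<open>Q = transpose P ** P'\<close> intertwines the diagonal matrices. Hence
  \<open>d i = d' j\<close> wherever \<open>Q $ i $ j\<close> is nonzero, so \<open>Q\<close> also
  intertwines their images under \<open>f\<close>.\<close>

lemma mat_fun_spectral:
  assumes P: "orthogonal_matrix P" and A: "A = P ** diag_matrix d ** transpose P"
  shows "mat_fun f A = P ** diag_matrix (\<lambda>i. f (d i)) ** transpose P"
  unfolding mat_fun_def
proof (rule the_equality)
  show "\<exists>P' d'. orthogonal_matrix P' \<and> A = P' ** diag_matrix d' ** transpose P' \<and>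
      P ** diag_matrix (\<lambda>i. f (d i)) ** transpose P = P' ** diag_matrix (\<lambda>i. f (d' i)) ** transpose P'"
    using assms by blast
next
  fix B
  assume "\<exists>P' d'. orthogonal_matrix P' \<and> A = P' ** diag_matrix d' ** transpose P' \<and>
      B = P' ** diag_matrix (\<lambda>i. f (d' i)) ** transpose P'"
  then obtain P' d' where P': "orthogonal_matrix P'" and A': "A = P' ** diag_matrix d' ** transpose P'"
    and B: "B = P' ** diag_matrix (\<lambda>i. f (d' i)) ** transpose P'" by blast
  define Q where "Q = transpose P ** P'"
  have unit: "P ** transpose P = mat 1" "transpose P ** P = mat 1"
      "P' ** transpose P' = mat 1" "transpose P' ** P' = mat 1"
    using P P' by (auto simp: orthogonal_matrix_def)
  have "diag_matrix d ** Q = (transpose P ** P) ** diag_matrix d ** (transpose P ** P')"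
    by (simp add: Q_def unit)
  also have "\<dots> = transpose P ** A ** P'"
    by (simp only: A matrix_mul_assoc)
  also have "\<dots> = (transpose P ** P') ** diag_matrix d' ** (transpose P' ** P')"
    by (simp only: A' matrix_mul_assoc)
  also have "\<dots> = Q ** diag_matrix d'"
    by (simp add: Q_def unit)
  finally have "diag_matrix d ** Q = Q ** diag_matrix d'" .
  then have "d i * Q $ i $ j = Q $ i $ j * d' j" for i j
    by (metis diag_matrix_mult_left diag_matrix_mult_right)
  then have "f (d i) * Q $ i $ j = Q $ i $ j * f (d' j)" for i j
    by (metis mult.commute mult_cancel_left)
  then have "diag_matrix (\<lambda>i. f (d i)) ** Q = Q ** diag_matrix (\<lambda>i. f (d' i))"
    by (simp add: vec_eq_iff diag_matrix_mult_left diag_matrix_mult_right)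
  then have *: "diag_matrix (\<lambda>i. f (d i)) ** (transpose P ** P')
      = (transpose P ** P') ** diag_matrix (\<lambda>i. f (d' i))"
    by (simp add: Q_def)
  have "P ** diag_matrix (\<lambda>i. f (d i)) ** transpose P
      = P ** diag_matrix (\<lambda>i. f (d i)) ** transpose P ** (P' ** transpose P')"
    by (simp add: unit)
  also have "\<dots> = P ** (diag_matrix (\<lambda>i. f (d i)) ** (transpose P ** P')) ** transpose P'"
    by (simp only: matrix_mul_assoc)
  also have "\<dots> = P ** ((transpose P ** P') ** diag_matrix (\<lambda>i. f (d' i))) ** transpose P'"
    by (simp only: *)
  also have "\<dots> = (P ** transpose P) ** B"
    by (simp only: B matrix_mul_assoc)
  finally show "B = P ** diag_matrix (\<lambda>i. f (d i)) ** transpose P"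
    by (simp add: unit)
qed

text \<open>In eigencoordinates a matrix function is multiplication by scalars. All later matrix
  identities are checked coordinatewise through this rule.\<close>

lemma transpose_mat_fun_mult_vec:
  assumes "orthogonal_matrix P" "A = P ** diag_matrix d ** transpose P"
  shows "(transpose P *v (mat_fun f A *v v)) $ i = f (d i) * (transpose P *v v) $ i"
proof -
  have "transpose P *v (mat_fun f A *v v) = diag_matrix (\<lambda>i. f (d i)) *v (transpose P *v v)"
    using assms(1)
    by (simp add: mat_fun_spectral[OF assms] orthogonal_matrix_def matrix_vector_mul_assoc
        matrix_mul_assoc del: transpose_matrix_vector)
  then show ?thesis by (simp add: diag_matrix_mult_vec)
qed

lemma mat_fun_id:
  assumes "orthogonal_matrix P" "A = P ** diag_matrix d ** transpose P"
  shows "mat_fun (\<lambda>z. z) A = A"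
  using mat_fun_spectral[OF assms, of "\<lambda>z. z"] assms(2) by simp

lemma inner_transpose_orthogonal:
  fixes P :: "real^'n^'n"
  assumes "orthogonal_matrix P"
  shows "(transpose P *v v) \<bullet> (transpose P *v w) = v \<bullet> w"
proof -
  have "(transpose P *v v) \<bullet> (transpose P *v w) = v \<bullet> (P *v (transpose P *v w))"
    by (metis dot_lmul_matrix transpose_matrix_vector)
  also have "\<dots> = v \<bullet> w"
    using assms
    by (simp add: matrix_vector_mul_assoc orthogonal_matrix_def del: transpose_matrix_vector)
  finally show ?thesis .
qed

lemma negative_spectrum:
  fixes A :: "real^'n^'n"
  assumes P: "orthogonal_matrix P" and A: "A = P ** diag_matrix d ** transpose P"
    and neg: "\<And>v. v \<noteq> 0 \<Longrightarrow> v \<bullet> (A *v v) < 0"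
  shows "d i < 0"
proof -
  \<comment> \<open>The \<open>i\<close>-th column of \<open>P\<close>, an eigenvector for
    \<open>d i\<close>.\<close>
  define v where "v = P *v axis i 1"
  have v: "transpose P *v v = axis i 1"
    using P by (simp add: v_def matrix_vector_mul_assoc orthogonal_matrix_def
        del: transpose_matrix_vector)
  then have "v \<noteq> 0"
    by (metis axis_eq_0_iff matrix_vector_mult_0_right zero_neq_one)
  then have "v \<bullet> (A *v v) < 0" by (rule neg)
  also have "v \<bullet> (A *v v) = (transpose P *v v) \<bullet> (transpose P *v (mat_fun (\<lambda>z. z) A *v v))"
    by (simp add: inner_transpose_orthogonal[OF P] mat_fun_id[OF P A] del: transpose_matrix_vector)
  also have "\<dots> = d i"
    by (simp add: v inner_axis' transpose_mat_fun_mult_vec[OF P A] del: transpose_matrix_vector)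
  finally show ?thesis .
qed

section \<open>Positivity of ternary quadratic forms and of Laplace integrals of cubics\<close>

text \<open>Sylvester's criterion, by completing the square twice; the factor \<open>a * ?m\<close>
  clears the denominators. The last hypothesis concerns the determinant of the symmetric matrix with
  diagonal \<open>a, b, c\<close> and off-diagonal entries \<open>d, e, f\<close>.\<close>

lemma quadratic_form3_nonneg:
  fixes a b c d e f x y z :: real
  assumes q: "q = a * x\<^sup>2 + b * y\<^sup>2 + c * z\<^sup>2 + 2 * d * x * y + 2 * e * x * z + 2 * f * y * z"
    and a: "0 < a" and m: "0 < a * b - d\<^sup>2"
    and det: "0 \<le> a * b * c + 2 * d * e * f - a * f\<^sup>2 - b * e\<^sup>2 - c * d\<^sup>2"
  shows "0 \<le> q"
proof -
  let ?m = "a * b - d\<^sup>2"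
  have "a * ?m * q = ?m * (a * x + d * y + e * z)\<^sup>2 + (?m * y + (a * f - d * e) * z)\<^sup>2
      + a * (a * b * c + 2 * d * e * f - a * f\<^sup>2 - b * e\<^sup>2 - c * d\<^sup>2) * z\<^sup>2"
    unfolding q by algebra
  also have "\<dots> \<ge> 0"
    using a m det by simp
  finally have "0 \<le> (a * ?m) * q" by simp
  moreover have "0 < a * ?m" using a m by simp
  ultimately show ?thesis
    using zero_le_mult_iff[of "a * ?m" q] by linarith
qed

definition cubic :: "real \<Rightarrow> real \<Rightarrow> real \<Rightarrow> real \<Rightarrow> real \<Rightarrow> real" where
  "cubic p0 p1 p2 p3 s = p0 + p1 * s + p2 * s\<^sup>2 + p3 * s ^ 3"

definition cubic_deriv :: "real \<Rightarrow> real \<Rightarrow> real \<Rightarrow> real \<Rightarrow> real" where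
  "cubic_deriv p1 p2 p3 s = p1 + 2 * p2 * s + 3 * p3 * s\<^sup>2"

(* Minus the factor of exp (- s / w) in a primitive of s \<mapsto> exp (- s / w) * cubic p0 p1 p2 p3 s. *)
definition laplace_factor :: "real \<Rightarrow> real \<Rightarrow> real \<Rightarrow> real \<Rightarrow> real \<Rightarrow> real \<Rightarrow> real" where
  "laplace_factor p0 p1 p2 p3 w s = cubic p0 p1 p2 p3 s * w + cubic_deriv p1 p2 p3 s * w\<^sup>2
     + (2 * p2 + 6 * p3 * s) * w ^ 3 + 6 * p3 * w ^ 4"

text \<open>The four hypotheses are the signs of the Bernstein coefficients on the interval from
  \<open>a\<close> to \<open>b\<close>, written through the values and slopes at its ends.\<close>

lemma cubic_nonneg_bernstein:
  assumes "0 \<le> cubic p0 p1 p2 p3 a"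
    and "0 \<le> cubic p0 p1 p2 p3 a + (b - a) / 3 * cubic_deriv p1 p2 p3 a"
    and "0 \<le> cubic p0 p1 p2 p3 b - (b - a) / 3 * cubic_deriv p1 p2 p3 b"
    and "0 \<le> cubic p0 p1 p2 p3 b"
    and s: "a \<le> s" "s \<le> b"
  shows "0 \<le> cubic p0 p1 p2 p3 s"
proof (cases "a = b")
  case True
  then show ?thesis using assms by auto
next
  case False
  then have ab: "0 < b - a" using s by auto
  define A B where "A = cubic p0 p1 p2 p3 a" and "B = cubic p0 p1 p2 p3 b"
  \<comment> \<open>Three times the inner Bernstein coefficients, which absorbs the binomial factor
    3.\<close>
  define A' B' where
    "A' = 3 * A + (b - a) * cubic_deriv p1 p2 p3 a"
    and "B' = 3 * B - (b - a) * cubic_deriv p1 p2 p3 b"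
  have "(b - a) ^ 3 * cubic p0 p1 p2 p3 s = (b - s) ^ 3 * A + (b - s)\<^sup>2 * (s - a) * A'
     + (b - s) * (s - a)\<^sup>2 * B' + (s - a) ^ 3 * B"
    unfolding A_def B_def A'_def B'_def cubic_def cubic_deriv_def by algebra
  also have "\<dots> \<ge> 0"
    using assms by (intro add_nonneg_nonneg mult_nonneg_nonneg) (auto simp: A_def B_def A'_def B'_def)
  finally show ?thesis
    using ab by (simp add: zero_le_mult_iff)
qed

text \<open>The right side minus the left side is the integral of \<open>exp (- s / w)\<close> times
  the cubic over the interval; monotonicity of the primitive replaces integration.\<close>

lemma laplace_factor_mono:
  assumes w: "0 < w" and ab: "a \<le> b"
    and "0 \<le> cubic p0 p1 p2 p3 a"
    and "0 \<le> cubic p0 p1 p2 p3 a + (b - a) / 3 * cubic_deriv p1 p2 p3 a"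
    and "0 \<le> cubic p0 p1 p2 p3 b - (b - a) / 3 * cubic_deriv p1 p2 p3 b"
    and "0 \<le> cubic p0 p1 p2 p3 b"
  shows "exp (- b / w) * laplace_factor p0 p1 p2 p3 w b
    \<le> exp (- a / w) * laplace_factor p0 p1 p2 p3 w a"
proof (rule DERIV_nonpos_imp_nonincreasing[OF ab])
  fix s assume s: "a \<le> s" "s \<le> b"
  have "((\<lambda>s. exp (- s / w) * laplace_factor p0 p1 p2 p3 w s) has_real_derivative
      - (exp (- s / w) * cubic p0 p1 p2 p3 s)) (at s)"
    unfolding laplace_factor_def cubic_def cubic_deriv_def using w
    by (auto intro!: derivative_eq_intros
        simp: field_simps power2_eq_square power3_eq_cube power4_eq_xxxx)
  moreover have "0 \<le> cubic p0 p1 p2 p3 s"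
    using cubic_nonneg_bernstein assms(3-6) s by blast
  ultimately show "\<exists>y. ((\<lambda>s. exp (- s / w) * laplace_factor p0 p1 p2 p3 w s)
      has_real_derivative y) (at s) \<and> y \<le> 0"
    by (intro exI conjI) auto
qed

section \<open>The phi-functions and the scalar stability form\<close>

lemma phi_1: "z \<noteq> 0 \<Longrightarrow> phi 1 z = (exp z - 1) / z"
  by simp

lemma phi_2: "z \<noteq> 0 \<Longrightarrow> phi 2 z = (phi 1 z - 1) / z"
  by (simp add: numeral_2_eq_2)

lemma phi_1_pos: "z < 0 \<Longrightarrow> 0 < phi 1 z"
  by (simp add: phi_1 divide_neg_neg)

lemma phi_2_pos:
  assumes "z < 0" shows "0 < phi 2 z"
proof -
  \<comment> \<open>Strictness comes from squaring \<open>1 + z / 2 \<le> exp (z / 2)\<close>, since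
    the square on the left exceeds \<open>1 + z\<close> by \<open>z\<^sup>2 / 4\<close>.\<close>
  have "1 + z < exp z"
  proof (cases "1 + z / 2 \<ge> 0")
    case True
    have "1 + z < (1 + z / 2)\<^sup>2"
      using assms by (simp add: power2_eq_square algebra_simps mult_neg_neg)
    also have "\<dots> \<le> (exp (z / 2))\<^sup>2"
      using True by (intro power_mono) auto
    also have "\<dots> = exp z"
      by (simp add: power2_eq_square flip: exp_add)
    finally show ?thesis .
  next
    case False
    then have "1 + z < 0" using assms by simp
    then show ?thesis using exp_gt_zero[of z] by linarith
  qed
  then have "phi 1 z < 1"
    using assms by (simp add: phi_1 field_simps)
  then show ?thesis
    using assms by (simp add: phi_2 divide_neg_neg del: phi.simps One_nat_def)
qed

(* With b chosen so that the density of S as a Laplace transform on [0, 1] is s \<mapsto> r1 - b * (1 - s), the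
   claim is the positivity of a Laplace transform at - z. *)
lemma stability_form_nonneg:
  fixes z r1 r2 b :: real
  assumes z: "z < 0"
  defines "r3 \<equiv> 32/25 * r1 - 7/25 * r2 - 21/25 * b"
    and "T \<equiv> (7/10 * phi 1 (7/10 * z) - (7/50 * phi 2 (z/2) + 49/50 * phi 2 (7/10 * z))) * r1
      + (7/50 * phi 2 (z/2) + 49/50 * phi 2 (7/10 * z)) * r2"
    and "S \<equiv> phi 1 z * r1 - phi 2 z * b"
  shows "0 \<le> phi 1 (z/2) / 2 * r1 * (r1 - r2) + (r2 - r3) * T + r3 * S + z / 2 * S\<^sup>2"
proof -
  \<comment> \<open>The reciprocal of the Laplace variable \<open>- z\<close>; \<open>ea\<close>,
    \<open>eb\<close>, \<open>ec\<close> are the values of \<open>exp (- s / w)\<close> at the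
    breakpoints 1/2, 7/10 and 1.\<close>
  define w where "w = - 1 / z"
  define ea eb ec where "ea = exp (- (1/2) / w)" and "eb = exp (- (7/10) / w)"
    and "ec = exp (- 1 / w)"
  have w: "0 < w" using z by (simp add: w_def divide_neg_neg)
  have e2: "exp (- 2 / w) = ec\<^sup>2"
    by (simp add: ec_def power2_eq_square flip: exp_add)
  have zw: "z = - 1 / w" using z by (simp add: w_def)
  have phi: "phi 1 z = w * (1 - ec)" "phi 2 z = w * (1 - w * (1 - ec))"
     "phi 1 (z/2) = 2 * w * (1 - ea)" "phi 2 (z/2) = 2 * w * (1 - 2 * w * (1 - ea))"
     "phi 1 (7/10 * z) = 10/7 * w * (1 - eb)"
     "phi 2 (7/10 * z) = 10/7 * w * (1 - 10/7 * w * (1 - eb))"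
    using w by (simp_all add: phi_1 phi_2 zw ea_def eb_def ec_def field_simps del: phi.simps One_nat_def)
  \<comment> \<open>The total mass of the densities of the first two terms, all of which lies below
    s = 7/10.\<close>
  define m where "m = r1 * (r1 - r2) / 2 + (r2 - r3) * (7/50 * r1 + 14/25 * r2)"
  (* The cubics are the four pieces, on [0, 1/2], [1/2, 7/10], [7/10, 1] and [1, 2], of the continuous
     function h with claimed quantity = - z * (Laplace transform of h); h is constant equal to ?F
     on [2, \<infinity>). *)
  let ?L1 = "laplace_factor 0
     (r1 * (r1 - r2) + (r2 - r3) * (42/25 * r2 - 17/25 * r1) + r3 * (r1 - b) - (r1 - b)\<^sup>2 / 2)
     ((64/25 * (r2 - r3) * (r1 - r2) + r3 * b - (r1 - b) * b) / 2) (- b\<^sup>2 / 12) w"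
  let ?L2 = "laplace_factor (r1 * (r1 - r2) / 2 - 7/100 * (r2 - r3) * (r1 - r2))
     ((r2 - r3) * (7/5 * r2 - 2/5 * r1) + r3 * (r1 - b) - (r1 - b)\<^sup>2 / 2)
     ((2 * (r2 - r3) * (r1 - r2) + r3 * b - (r1 - b) * b) / 2) (- b\<^sup>2 / 12) w"
  let ?L3 = "laplace_factor m (r3 * (r1 - b) - (r1 - b)\<^sup>2 / 2)
     ((r3 * b - (r1 - b) * b) / 2) (- b\<^sup>2 / 12) w"
  let ?F = "m + r3 * (r1 - b / 2)"
  let ?L4 = "laplace_factor (?F - r1\<^sup>2 + 2 * r1 * b - 2/3 * b\<^sup>2)
     (r1\<^sup>2 / 2 - 2 * r1 * b + b\<^sup>2) (r1 * b / 2 - b\<^sup>2 / 2) (b\<^sup>2 / 12) w"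
  note defs = cubic_def cubic_deriv_def m_def r3_def power2_eq_square power3_eq_cube
    algebra_simps add_divide_distrib diff_divide_distrib
  \<comment> \<open>Each of the four comparisons checks the Bernstein coefficients of one piece as
    quadratic forms in \<open>r1\<close>, \<open>r2\<close>, \<open>b\<close>. The rationals are the
    diagonal entries, interleaved with the variables, and then the off-diagonal ones. The very first
    coefficient is h(0) = 0; continuity of h makes the forms at common breakpoints coincide.\<close>
  have 1: "ea * ?L1 (1/2) \<le> exp (- 0 / w) * ?L1 0"
    unfolding ea_def
    apply (rule laplace_factor_mono[OF w])
    subgoal by simp
    subgoal by (simp add: defs)
    subgoal by (rule quadratic_form3_nonneg[of _ "3313/7500" "r1" "224/625" "r2" "17/300" "b" "-224/625" "-1057/7500" "1057/7500"])
      (simp_all add: defs)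
    subgoal by (rule quadratic_form3_nonneg[of _ "2801/3750" "r1" "1088/1875" "r2" "3/25" "b" "-1088/1875" "-6937/30000" "6937/30000"])
      (simp_all add: defs)
    subgoal by (rule quadratic_form3_nonneg[of _ "2289/2500" "r1" "416/625" "r2" "431/2400" "b" "-416/625" "-2709/10000" "2709/10000"])
      (simp_all add: defs)
    done
  have 2: "eb * ?L2 (7/10) \<le> ea * ?L2 (1/2)"
    unfolding ea_def eb_def
    apply (rule laplace_factor_mono[OF w])
    subgoal by simp
    subgoal by (rule quadratic_form3_nonneg[of _ "2289/2500" "r1" "416/625" "r2" "431/2400" "b" "-416/625" "-2709/10000" "2709/10000"])
      (simp_all add: defs)
    subgoal by (rule quadratic_form3_nonneg[of _ "2291/2500" "r1" "1312/1875" "r2" "2441/12000" "b" "-833/1250" "-8603/30000" "8603/30000"])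
      (simp_all add: defs)
    subgoal by (rule quadratic_form3_nonneg[of _ "6751/7500" "r1" "448/625" "r2" "4533/20000" "b" "-1219/1875" "-2961/10000" "2961/10000"])
      (simp_all add: defs)
    subgoal by (rule quadratic_form3_nonneg[of _ "2167/2500" "r1" "448/625" "r2" "14917/60000" "b" "-771/1250" "-2989/10000" "2989/10000"])
      (simp_all add: defs)
    done
  have 3: "ec * ?L3 1 \<le> eb * ?L3 (7/10)"
    unfolding ec_def eb_def
    apply (rule laplace_factor_mono[OF w])
    subgoal by simp
    subgoal by (rule quadratic_form3_nonneg[of _ "2167/2500" "r1" "448/625" "r2" "14917/60000" "b" "-771/1250" "-2989/10000" "2989/10000"])
      (simp_all add: defs)
    subgoal by (rule quadratic_form3_nonneg[of _ "1181/1250" "r1" "448/625" "r2" "8447/30000" "b" "-1577/2500" "-3451/10000" "3031/10000"])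
      (simp_all add: defs)
    subgoal by (rule quadratic_form3_nonneg[of _ "2557/2500" "r1" "448/625" "r2" "187/600" "b" "-403/625" "-973/2500" "763/2500"])
      (simp_all add: defs)
    subgoal by (rule quadratic_form3_nonneg[of _ "688/625" "r1" "448/625" "r2" "101/300" "b" "-1647/2500" "-539/1250" "763/2500"])
      (simp_all add: defs)
    done
  have 4: "ec\<^sup>2 * ?L4 2 \<le> ec * ?L4 1"
    unfolding e2[symmetric] unfolding ec_def
    apply (rule laplace_factor_mono[OF w])
    subgoal by simp
    subgoal by (rule quadratic_form3_nonneg[of _ "688/625" "r1" "448/625" "r2" "101/300" "b" "-1647/2500" "-539/1250" "763/2500"])
      (simp_all add: defs)
    subgoal by (rule quadratic_form3_nonneg[of _ "4753/3750" "r1" "448/625" "r2" "21/50" "b" "-1647/2500" "-1121/1875" "763/2500"])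
      (simp_all add: defs)
    subgoal by (rule quadratic_form3_nonneg[of _ "2689/1875" "r1" "448/625" "r2" "21/50" "b" "-1647/2500" "-1703/2500" "763/2500"])
      (simp_all add: defs)
    subgoal by (rule quadratic_form3_nonneg[of _ "2001/1250" "r1" "448/625" "r2" "21/50" "b" "-1647/2500" "-1703/2500" "763/2500"])
      (simp_all add: defs)
    done
  have 5: "0 \<le> ?F"
    by (rule quadratic_form3_nonneg[of _ "2001/1250" "r1" "448/625" "r2" "21/50" "b" "-1647/2500" "-1703/2500" "763/2500"])
      (simp_all add: defs)
  \<comment> \<open>The Laplace transform of h at \<open>1 / w\<close>, piece by piece; the last
    summand is the tail from 2 to infinity.\<close>
  have "0 \<le> ?L1 0 - ea * ?L1 (1/2) + ea * ?L2 (1/2) - eb * ?L2 (7/10) + eb * ?L3 (7/10)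
     - ec * ?L3 1 + ec * ?L4 1 - ec\<^sup>2 * ?L4 2 + w * ec\<^sup>2 * ?F"
    using 1 2 3 4 5 w by simp
  \<comment> \<open>Taking a primitive multiplies the transform by \<open>w\<close>, and the
    self-convolution becomes the square of \<open>S\<close>.\<close>
  also have "\<dots> = w * (w * (1 - ea) * r1 * (r1 - r2) + (r2 - r3) * T + r3 * S) - S\<^sup>2 / 2"
    unfolding T_def S_def phi laplace_factor_def cubic_def cubic_deriv_def m_def
    by (simp add: power2_eq_square power3_eq_cube power4_eq_xxxx
        algebra_simps add_divide_distrib diff_divide_distrib)
  also have "\<dots> = w * (phi 1 (z/2) / 2 * r1 * (r1 - r2) + (r2 - r3) * T + r3 * S + z / 2 * S\<^sup>2)"
    using w unfolding phi by (simp add: zw field_simps)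
  finally show ?thesis
    using w by (simp add: zero_le_mult_iff)
qed

section \<open>Algebra of the differentiation matrix\<close>

text \<open>The recursion for \<open>theta\<close> is the off-diagonal equation of a triangular left
  inverse, solved for its summand \<open>l = j\<close>.\<close>

lemma theta_mult_diff_coeff:
  assumes nz: "\<And>k. k \<in> {1..s} \<Longrightarrow> diff_coeff a (k + 1) k z \<noteq> 0"
    and k: "k \<le> s" and j: "1 \<le> j" "j \<le> k"
  shows "(\<Sum>l = j..k. theta a k l z * diff_coeff a (l + 1) j z) = (if j = k then 1 else 0)"
proof (cases "j = k")
  case True
  then show ?thesis using nz[of k] assms by (simp add: theta.simps)
next
  case False
  have nzj: "diff_coeff a (j + 1) j z \<noteq> 0" using nz[of j] k j by simp
  have "theta a k j z * diff_coeff a (j + 1) j z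
      = - (\<Sum>l = j + 1..k. theta a k l z * diff_coeff a (l + 1) j z)"
    using False j nzj by (subst theta.simps) (simp add: sum_divide_distrib[symmetric])
  then show ?thesis
    using False j by (simp add: sum.atLeast_Suc_atMost)
qed

lemma theta_solves_triangular:
  assumes nz: "\<And>k. k \<in> {1..s} \<Longrightarrow> diff_coeff a (k + 1) k z \<noteq> 0"
    and y: "\<And>l. l \<in> {1..s} \<Longrightarrow> y l = (\<Sum>j = 1..l. diff_coeff a (l + 1) j z * r j)"
    and k: "k \<in> {1..s}"
  shows "(\<Sum>l = 1..k. theta a k l z * y l) = r k"
proof -
  have "(\<Sum>l = 1..k. theta a k l z * y l)
      = (\<Sum>l = 1..k. \<Sum>j = 1..l. theta a k l z * diff_coeff a (l + 1) j z * r j)"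
    using y k by (intro sum.cong) (auto simp: sum_distrib_left mult.assoc)
  also have "\<dots> = (\<Sum>j = 1..k. \<Sum>l = j..k. theta a k l z * diff_coeff a (l + 1) j z * r j)"
    unfolding sum.Sigma[OF finite_atLeastAtMost, simplified]
    by (subst (1 2) sum.Sigma) (auto intro!: sum.reindex_bij_witness[of _ "\<lambda>(x, y). (y, x)" "\<lambda>(x, y). (y, x)"])
  also have "\<dots> = (\<Sum>j = 1..k. (if j = k then 1 else 0) * r j)"
  proof (rule sum.cong[OF refl])
    fix j assume "j \<in> {1..k}"
    then have "(\<Sum>l = j..k. theta a k l z * diff_coeff a (l + 1) j z) = (if j = k then 1 else 0)"
      using k by (intro theta_mult_diff_coeff[OF nz]) auto
    then show "(\<Sum>l = j..k. theta a k l z * diff_coeff a (l + 1) j z * r j)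
        = (if j = k then 1 else 0) * r j"
      by (simp only: flip: sum_distrib_right)
  qed
  also have "\<dots> = r k"
    using k by (simp add: if_distrib[of "\<lambda>x. x * _"] cong: if_cong)
  finally show ?thesis .
qed

text \<open>When \<open>y\<close> consists of stage differences, the bracket is the midpoint of
  stages \<open>k\<close> and \<open>k + 1\<close> minus the first stage.\<close>

lemma diff_matrix_row:
  assumes "1 \<le> k"
  shows "(\<Sum>l = 1..k. diff_matrix a k l z * y l)
    = (\<Sum>l = 1..k. theta a k l z * y l) + z * ((\<Sum>l = 1..k. y l) - y k / 2)"
proof -
  have "(\<Sum>l = 1..k. diff_matrix a k l z * y l)
     = (\<Sum>l = 1..k. theta a k l z * y l + z * y l - (if l = k then z / 2 * y k else 0))"
    by (intro sum.cong) (auto simp: diff_matrix_def algebra_simps)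
  also have "\<dots> = (\<Sum>l = 1..k. theta a k l z * y l) + z * (\<Sum>l = 1..k. y l) - z / 2 * y k"
    using assms by (simp add: sum_subtractf sum.distrib sum_distrib_left)
  finally show ?thesis by (simp add: algebra_simps)
qed

text \<open>The part of the matrix added to \<open>theta\<close> has symmetric part
  \<open>z / 2\<close> times the all-ones matrix, hence the perfect square.\<close>

lemma diff_matrix_form:
  "(\<Sum>k = 1..j. y k * (\<Sum>l = 1..k. diff_matrix a k l z * y l))
    = (\<Sum>k = 1..j. y k * (\<Sum>l = 1..k. theta a k l z * y l)) + z / 2 * (\<Sum>k = 1..j. y k)\<^sup>2"
proof (induction j)
  case (Suc j)
  have step: "(\<Sum>k = 1..Suc j. f k) = (\<Sum>k = 1..j. f k) + f (Suc j)" for f :: "nat \<Rightarrow> real"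
    by simp
  show ?case
    unfolding step[of "\<lambda>k. y k * (\<Sum>l = 1..k. diff_matrix a k l z * y l)"]
      step[of "\<lambda>k. y k * (\<Sum>l = 1..k. theta a k l z * y l)"] step[of y] Suc.IH
      diff_matrix_row[of "Suc j" a z y, OF le_add1[of 1 j, unfolded plus_1_eq_Suc]]
    by (simp add: power2_eq_square algebra_simps)
qed simp

section \<open>Stage differences of the scheme\<close>

lemma stage_diff_eq:
  assumes sol: "eerk_solution s a L g \<kappa> \<tau> u U" and n: "1 \<le> n" and k: "k \<in> {1..s}"
  defines "A \<equiv> - (\<tau> *\<^sub>R L_stab L \<kappa>)"
    and "r \<equiv> \<lambda>j. \<tau> *\<^sub>R g_stab g \<kappa> (U n j) - \<tau> *\<^sub>R (L_stab L \<kappa> *v U n 1)"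
  shows "stage_diff U n (k + 1) = (\<Sum>j = 1..k. mat_fun (a (k + 1) j) A *v r j)
     - (\<Sum>j = 1..<k. mat_fun (a k j) A *v r j)"
proof -
  have U: "U n (i + 1) = U n 1 + (\<Sum>j = 1..i. mat_fun (a (i + 1) j) A *v r j)" if "i \<in> {1..s}" for i
    using sol n that unfolding eerk_solution_def A_def r_def by blast
  \<comment> \<open>The first stage has no update formula, but for \<open>k = 1\<close> the sum is
    empty.\<close>
  have "U n k = U n 1 + (\<Sum>j = 1..<k. mat_fun (a k j) A *v r j)"
  proof (cases "k = 1")
    case False
    then have "{1..<k} = {1..k - 1}" "k - 1 \<in> {1..s}" "k - 1 + 1 = k"
      using k by auto
    then show ?thesis
      using U[of "k - 1"] by simp
  qed simp
  then show ?thesis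
    using U[OF k] by (simp add: stage_diff_def)
qed

lemma neg_scaleR_matrix_vector_mult:
  fixes A :: "real^'n^'m"
  shows "(- (c *\<^sub>R A)) *v v = - (c *\<^sub>R (A *v v))"
  by (simp add: vec_eq_iff matrix_vector_mult_def sum_negf sum_distrib_left mult.assoc)

text \<open>In eigencoordinates \<open>theta\<close> recovers \<open>r k\<close> from the stage
  differences, and the remaining part adds the matrix applied to the midpoint displacement. The
  contributions of \<open>U n 1\<close> cancel.\<close>

lemma diff_matrix_stage_diff:
  assumes sol: "eerk_solution s a L g \<kappa> \<tau> u U" and n: "1 \<le> n" and k: "k \<in> {1..s}"
    and P: "orthogonal_matrix P" and A: "- (\<tau> *\<^sub>R L_stab L \<kappa>) = P ** diag_matrix d ** transpose P"
    and nz: "\<And>i k. k \<in> {1..s} \<Longrightarrow> diff_coeff a (k + 1) k (d i) \<noteq> 0"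
  shows "(\<Sum>l = 1..k. mat_fun (diff_matrix a k l) (- (\<tau> *\<^sub>R L_stab L \<kappa>)) *v stage_diff U n (l + 1))
    = \<tau> *\<^sub>R (g_stab g \<kappa> (U n k) - (1 / 2) *\<^sub>R (L_stab L \<kappa> *v (U n k + U n (k + 1))))"
    (is "?lhs = ?rhs")
proof -
  define r where "r j = \<tau> *\<^sub>R g_stab g \<kappa> (U n j) - \<tau> *\<^sub>R (L_stab L \<kappa> *v U n 1)" for j
  let ?A = "- (\<tau> *\<^sub>R L_stab L \<kappa>)"
  let ?h = "\<lambda>v i. (transpose P *v v) $ i"
  note spec = transpose_mat_fun_mult_vec[OF P A]
  have hsum: "?h (\<Sum>j\<in>J. v j) i = (\<Sum>j\<in>J. ?h (v j) i)" for v :: "nat \<Rightarrow> _" and J i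
    by (simp add: linear_sum[OF matrix_vector_mul_linear] del: transpose_matrix_vector)
  have y: "?h (stage_diff U n (l + 1)) i = (\<Sum>j = 1..l. diff_coeff a (l + 1) j (d i) * ?h (r j) i)"
    if l: "l \<in> {1..s}" for l i
  proof -
    have "?h (stage_diff U n (l + 1)) i
      = (\<Sum>j = 1..l. a (l + 1) j (d i) * ?h (r j) i) - (\<Sum>j = 1..<l. a l j (d i) * ?h (r j) i)"
      unfolding stage_diff_eq[OF sol n l] r_def[symmetric]
      by (simp add: matrix_vector_mult_diff_distrib hsum spec del: transpose_matrix_vector)
    also have "\<dots> = (\<Sum>j = 1..l. diff_coeff a (l + 1) j (d i) * ?h (r j) i)"
    proof -
      have *: "{1..l} = insert l {1..<l}" using l by auto
      show ?thesis unfolding *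
        by (simp add: diff_coeff_def sum_subtractf[symmetric] left_diff_distrib)
    qed
    finally show ?thesis .
  qed
  have tel: "(\<Sum>l = 1..k. stage_diff U n (l + 1)) = U n (k + 1) - U n 1" for k
    by (induction k) (simp_all add: stage_diff_def)
  have "transpose P *v ?lhs = transpose P *v (r k + ?A *v ((1 / 2) *\<^sub>R (U n k + U n (k + 1)) - U n 1))"
  proof (rule vec_eq_iff[THEN iffD2, rule_format])
    fix i
    have "?h ?lhs i = (\<Sum>l = 1..k. diff_matrix a k l (d i) * ?h (stage_diff U n (l + 1)) i)"
      by (simp only: hsum spec)
    also have "\<dots> = ?h (r k) i + d i * ((\<Sum>l = 1..k. ?h (stage_diff U n (l + 1)) i) - ?h (stage_diff U n (k + 1)) i / 2)"
    proof -
      have "(\<Sum>l = 1..k. theta a k l (d i) * ?h (stage_diff U n (l + 1)) i) = ?h (r k) i"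
        by (rule theta_solves_triangular[OF nz y k])
      then show ?thesis
        using diff_matrix_row[of k a "d i" "\<lambda>l. ?h (stage_diff U n (l + 1)) i"] k by simp
    qed
    also have "(\<Sum>l = 1..k. ?h (stage_diff U n (l + 1)) i) - ?h (stage_diff U n (k + 1)) i / 2
       = ?h ((1 / 2) *\<^sub>R (U n k + U n (k + 1)) - U n 1) i"
      unfolding hsum[symmetric] tel
      by (simp add: stage_diff_def matrix_vector_mult_diff_distrib matrix_vector_right_distrib
          matrix_vector_mult_scaleR field_simps del: transpose_matrix_vector)
    also have "d i * \<dots> = ?h (?A *v ((1 / 2) *\<^sub>R (U n k + U n (k + 1)) - U n 1)) i"
      using spec[of "\<lambda>z. z"] mat_fun_id[OF P A] by metis
    finally show "?h ?lhs i = ?h (r k + ?A *v ((1 / 2) *\<^sub>R (U n k + U n (k + 1)) - U n 1)) i"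
      by (simp add: matrix_vector_right_distrib del: transpose_matrix_vector)
  qed
  then have "P *v (transpose P *v ?lhs) = P *v (transpose P *v (r k + ?A *v ((1 / 2) *\<^sub>R (U n k + U n (k + 1)) - U n 1)))"
    by simp
  then have "?lhs = r k + ?A *v ((1 / 2) *\<^sub>R (U n k + U n (k + 1)) - U n 1)"
    using P by (simp add: matrix_vector_mul_assoc orthogonal_matrix_def del: transpose_matrix_vector)
  also have "\<dots> = ?rhs"
    by (simp add: r_def matrix_vector_mult_diff_distrib matrix_vector_right_distrib
        matrix_vector_mult_scaleR neg_scaleR_matrix_vector_mult algebra_simps flip: scaleR_left_distrib)
  finally show ?thesis .
qed

section \<open>Energy increment of one stage\<close>

text \<open>Symmetry of \<open>L\<close> makes the quadratic part exact. The mean value theorem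
  leaves an error of at most \<open>lg\<close> times the squared norm of \<open>w - v\<close>, which
  the surplus \<open>\<kappa> / 2 * ((w - v) \<bullet> (w - v))\<close> of the stabilized terms
  absorbs.\<close>

lemma energy_step_le:
  assumes sym: "transpose L = L"
    and grad: "\<And>v. ((\<lambda>w. G w \<bullet> 1) has_derivative (\<lambda>h. (- g v) \<bullet> h)) (at v)"
    and lip: "lg-lipschitz_on UNIV g" and kappa: "2 * lg \<le> \<kappa>"
  shows "energy L G w - energy L G v
    \<le> (w - v) \<bullet> ((1 / 2) *\<^sub>R (L_stab L \<kappa> *v (v + w)) - g_stab g \<kappa> v)"
proof -
  define F where "F t = G (v + t *\<^sub>R (w - v)) \<bullet> 1" for t :: real
  have "(F has_real_derivative (- g (v + t *\<^sub>R (w - v)) \<bullet> (w - v))) (at t)" for t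
  proof -
    have "((\<lambda>t. v + t *\<^sub>R (w - v)) has_derivative (\<lambda>h. h *\<^sub>R (w - v))) (at t)"
      by (auto intro!: derivative_eq_intros)
    from has_derivative_compose[OF this grad] show ?thesis
      unfolding F_def has_field_derivative_def
      by (rule has_derivative_eq_rhs) (auto simp: fun_eq_iff)
  qed
  then obtain t where t: "0 < t" "t < 1" "F 1 - F 0 = - g (v + t *\<^sub>R (w - v)) \<bullet> (w - v)"
    using MVT2[of 0 1 F "\<lambda>t. - g (v + t *\<^sub>R (w - v)) \<bullet> (w - v)"] by auto
  have "norm (g v - g (v + t *\<^sub>R (w - v))) \<le> lg * norm (t *\<^sub>R (w - v))"
    using lipschitz_onD[OF lip, of v "v + t *\<^sub>R (w - v)"] by (simp add: dist_norm)
  also have "\<dots> \<le> lg * norm (w - v)"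
    using t lipschitz_on_nonneg[OF lip] by (intro mult_left_mono) (auto simp: mult_left_le_one_le)
  finally have "(g v - g (v + t *\<^sub>R (w - v))) \<bullet> (w - v) \<le> lg * norm (w - v) * norm (w - v)"
    by (meson norm_cauchy_schwarz mult_right_mono norm_ge_zero order_trans)
  also have "\<dots> \<le> \<kappa> / 2 * ((w - v) \<bullet> (w - v))"
    using mult_right_mono[of lg "\<kappa> / 2" "(norm (w - v))\<^sup>2"] kappa
    by (simp add: dot_square_norm power2_eq_square mult.assoc)
  finally have *: "F 1 - F 0 \<le> - (g v \<bullet> (w - v)) + \<kappa> / 2 * ((w - v) \<bullet> (w - v))"
    using t(3) by (simp add: inner_diff_left)
  have self: "v \<bullet> (L *v w) = w \<bullet> (L *v v)"
    by (metis dot_lmul_matrix sym transpose_matrix_vector inner_commute)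
  have "energy L G w - energy L G v = (w \<bullet> (L *v w) - v \<bullet> (L *v v)) / 2 + (F 1 - F 0)"
    by (simp add: energy_def F_def field_simps)
  also have "w \<bullet> (L *v w) - v \<bullet> (L *v v) = (w - v) \<bullet> (L *v (v + w))"
    using self by (simp add: matrix_vector_right_distrib inner_diff_left inner_add_right)
  finally show ?thesis
    using * by (simp add: L_stab_def g_stab_def matrix_vector_mult_add_rdistrib
        scaleR_matrix_vector_assoc[symmetric] inner_diff_left inner_diff_right inner_add_left
        inner_add_right inner_commute field_simps)
qed

section \<open>The method with abscissas 1/2 and 7/10\<close>

text \<open>Here the parameter gamma is 7/25 and \<open>\<gamma> * c2 + c3\<close> is 21/25, so the
  last-row weights of \<open>phi 2 z\<close> are 1/3 and 25/21.\<close>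

lemma eerk32_diff_coeff:
  fixes z :: real
  defines "a \<equiv> eerk32 (1/2) (7/10)"
  defines "a32 \<equiv> 7/50 * phi 2 (z/2) + 49/50 * phi 2 (7/10 * z)"
  shows "diff_coeff a 2 1 z = phi 1 (z/2) / 2"
    and "diff_coeff a 3 1 z = 7/10 * phi 1 (7/10 * z) - a32 - phi 1 (z/2) / 2"
    and "diff_coeff a 3 2 z = a32"
    and "diff_coeff a 4 1 z = phi 1 z - 32/21 * phi 2 z - (7/10 * phi 1 (7/10 * z) - a32)"
    and "diff_coeff a 4 2 z = phi 2 z / 3 - a32"
    and "diff_coeff a 4 3 z = 25/21 * phi 2 z"
  by (simp_all add: a_def a32_def diff_coeff_def eerk32_def Let_def power2_eq_square del: phi.simps One_nat_def)

text \<open>Ensures that \<open>theta\<close> does not divide by zero on the negative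
  spectrum.\<close>

lemma eerk32_diff_coeff_pos:
  assumes "z < 0" "k \<in> {1..3}"
  shows "0 < diff_coeff (eerk32 (1/2) (7/10)) (k + 1) k z"
proof -
  have "k = 1 \<or> k = 2 \<or> k = 3" using assms(2) by auto
  then show ?thesis
    using assms(1) eerk32_diff_coeff[of z] phi_1_pos[of "z/2"] phi_2_pos[of z] phi_2_pos[of "z/2"]
      phi_2_pos[of "7/10 * z"]
    by (elim disjE) (simp_all add: add_pos_pos del: phi.simps One_nat_def)
qed

lemma eerk32_diff_matrix_nonneg:
  fixes y :: "nat \<Rightarrow> real"
  assumes z: "z < 0" and j: "j \<le> 3"
  defines "a \<equiv> eerk32 (1/2) (7/10)"
  shows "0 \<le> (\<Sum>k = 1..j. y k * (\<Sum>l = 1..k. diff_matrix a k l z * y l))"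
proof -
  \<comment> \<open>Padding with zeros reduces every \<open>j\<close> to the full form with three
    stages.\<close>
  define x where "x k = (if k \<le> j then y k else 0)" for k
  note coeff = eerk32_diff_coeff[of z, folded a_def]
  have nz: "diff_coeff a (k + 1) k z \<noteq> 0" if "k \<in> {1..3}" for k
    using eerk32_diff_coeff_pos[OF z that] by (simp add: a_def)
  \<comment> \<open>Forward substitution in the triangular system.\<close>
  define r1 where "r1 = x 1 / diff_coeff a 2 1 z"
  define r2 where "r2 = (x 2 - diff_coeff a 3 1 z * r1) / diff_coeff a 3 2 z"
  define r3 where "r3 = (x 3 - diff_coeff a 4 1 z * r1 - diff_coeff a 4 2 z * r2) / diff_coeff a 4 3 z"
  define r where "r k = (if k = 1 then r1 else if k = 2 then r2 else r3)" for k :: nat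
  have x: "x 1 = diff_coeff a 2 1 z * r1"
    "x 2 = diff_coeff a 3 1 z * r1 + diff_coeff a 3 2 z * r2"
    "x 3 = diff_coeff a 4 1 z * r1 + diff_coeff a 4 2 z * r2 + diff_coeff a 4 3 z * r3"
    using nz[of 1] nz[of 2] nz[of 3] by (simp_all add: r1_def r2_def r3_def del: One_nat_def)
  have set3: "{1..3} = {1, 2, 3 :: nat}" and set2: "{1..2} = {1, 2 :: nat}" by auto
  have tri: "x l = (\<Sum>i = 1..l. diff_coeff a (l + 1) i z * r i)" if "l \<in> {1..3}" for l
    using that x unfolding set3 by (auto simp: set2 set3 r_def simp del: One_nat_def)
  have "(\<Sum>k = 1..j. y k * (\<Sum>l = 1..k. diff_matrix a k l z * y l))
      = (\<Sum>k = 1..j. x k * (\<Sum>l = 1..k. diff_matrix a k l z * x l))"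
    by (intro sum.cong arg_cong2[where f = "(*)"]) (auto simp: x_def)
  also have "\<dots> = (\<Sum>k = 1..3. x k * (\<Sum>l = 1..k. diff_matrix a k l z * x l))"
    using j by (intro sum.mono_neutral_left) (auto simp: x_def)
  also have "\<dots> = (\<Sum>k = 1..3. x k * r k) + z / 2 * (\<Sum>k = 1..3. x k)\<^sup>2"
  proof -
    have theta: "(\<Sum>l = 1..k. theta a k l z * x l) = r k" if "k \<in> {1..3}" for k
      by (rule theta_solves_triangular[OF nz tri that])
    have "(\<Sum>k = 1..3. x k * (\<Sum>l = 1..k. theta a k l z * x l)) = (\<Sum>k = 1..3. x k * r k)"
      by (rule sum.cong[OF refl]) (simp only: theta)
    then show ?thesis
      unfolding diff_matrix_form by (simp only:)
  qed
  also have "\<dots> \<ge> 0"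
  proof -
    \<comment> \<open>Collects the \<open>phi 2 z\<close> terms of the total \<open>S\<close>.
      Below, \<open>A * r1\<close>, \<open>T\<close> and \<open>S\<close> are the partial sums of
      \<open>x\<close>, so summation by parts yields the form in
      \<open>stability_form_nonneg\<close>.\<close>
    define b where "b = 32/21 * r1 - r2 / 3 - 25/21 * r3"
    have r3: "r3 = 32/25 * r1 - 7/25 * r2 - 21/25 * b" by (simp add: b_def field_simps)
    define A where "A = phi 1 (z/2) / 2"
    define T where "T = (7/10 * phi 1 (7/10 * z) - (7/50 * phi 2 (z/2) + 49/50 * phi 2 (7/10 * z))) * r1
      + (7/50 * phi 2 (z/2) + 49/50 * phi 2 (7/10 * z)) * r2"
    define S where "S = phi 1 z * r1 - phi 2 z * b"
    have x1: "x 1 = A * r1"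
      by (simp only: x coeff A_def)
    have x2: "x 2 = T - A * r1"
      by (simp add: x coeff A_def T_def algebra_simps del: phi.simps One_nat_def)
    have x3: "x 3 = S - T"
      by (simp add: x coeff S_def T_def b_def algebra_simps del: phi.simps One_nat_def)
    have "(\<Sum>k = 1..3. x k * r k) + z / 2 * (\<Sum>k = 1..3. x k)\<^sup>2
      = A * r1 * (r1 - r2) + (r2 - r3) * T + r3 * S + z / 2 * S\<^sup>2"
      unfolding set3 by (simp add: r_def x1 x2 x3 algebra_simps del: One_nat_def)
    then show ?thesis
      using stability_form_nonneg[OF z, of r1 r2 b, folded r3 A_def T_def S_def] by (simp only:)
  qed
  finally show ?thesis .
qed

section \<open>Energy dissipation at all stages\<close>

theorem corollary4p4:
  fixes L :: "real^'n^'n" and G g :: "real^'n \<Rightarrow> real^'n" and \<kappa> \<tau> lg :: real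
    and u :: "nat \<Rightarrow> real^'n" and U :: "nat \<Rightarrow> nat \<Rightarrow> real^'n" and n j :: nat
  assumes L_spd: "sym_pos_def L"
    and G_nonneg: "\<And>v i. 0 \<le> G v $ i"
    and G_gradient: "\<And>v. ((\<lambda>w. G w \<bullet> 1) has_derivative (\<lambda>h. (- g v) \<bullet> h)) (at v)"
    and lg_pos: "lg > 0"
    and g_lipschitz: "lg-lipschitz_on UNIV g"
    and kappa: "\<kappa> \<ge> 2 * lg"
    and tau: "\<tau> > 0"
    and scheme: "eerk_solution 3 (eerk32 (1/2) (7/10)) L g \<kappa> \<tau> u U"
    and n: "n \<ge> 1"
    and j: "j \<in> {1..3}"
  shows "let Q = - (1 / \<tau>) * (\<Sum>k = 1..j. stage_diff U n (k + 1) \<bullet>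
      (\<Sum>l = 1..k. mat_fun (diff_matrix (eerk32 (1/2) (7/10)) k l) (- (\<tau> *\<^sub>R L_stab L \<kappa>)) *v
        stage_diff U n (l + 1)))
    in energy L G (U n (j + 1)) - energy L G (U n 1) \<le> Q \<and> Q \<le> 0"
proof -
  let ?a = "eerk32 (1/2) (7/10)"
  define A where "A = - (\<tau> *\<^sub>R L_stab L \<kappa>)"
  define \<delta> where "\<delta> k = stage_diff U n (k + 1)" for k
  define D where "D k = (\<Sum>l = 1..k. mat_fun (diff_matrix ?a k l) A *v \<delta> l)" for k
  have L_sym: "transpose L = L" and L_pos: "\<And>v. v \<noteq> 0 \<Longrightarrow> 0 < v \<bullet> (L *v v)"
    using L_spd by (auto simp: sym_pos_def_def)
  have A_mult: "A *v v = - (\<tau> *\<^sub>R (L *v v + \<kappa> *\<^sub>R v))" for v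
    by (simp add: A_def neg_scaleR_matrix_vector_mult L_stab_def matrix_vector_mult_add_rdistrib
        flip: scaleR_matrix_vector_assoc)
  have "transpose A = A"
    using L_sym by (simp add: A_def L_stab_def transpose_def vec_eq_iff mat_def)
  then obtain P d where P: "orthogonal_matrix P" and A: "A = P ** diag_matrix d ** transpose P"
    by (rule symmetric_matrix_diagonalizable)
  have "v \<bullet> (A *v v) < 0" if "v \<noteq> 0" for v
  proof -
    have "0 < v \<bullet> (L *v v) + \<kappa> * (v \<bullet> v)"
      using L_pos[OF that] kappa lg_pos by (simp add: add_pos_nonneg)
    then show ?thesis
      using tau by (simp add: A_mult inner_add_right)
  qed
  then have neg: "d i < 0" for i
    by (rule negative_spectrum[OF P A])
  have nz: "diff_coeff ?a (k + 1) k (d i) \<noteq> 0" if "k \<in> {1..3}" for i k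
    using eerk32_diff_coeff_pos[OF neg that, of i] by simp
  have step: "energy L G (U n (k + 1)) - energy L G (U n k) \<le> - (1 / \<tau>) * (\<delta> k \<bullet> D k)"
    if k: "k \<in> {1..3}" for k
  proof -
    have D: "D k = \<tau> *\<^sub>R (g_stab g \<kappa> (U n k) - (1 / 2) *\<^sub>R (L_stab L \<kappa> *v (U n k + U n (k + 1))))"
      unfolding D_def \<delta>_def A_def
      by (rule diff_matrix_stage_diff[OF scheme n k P A[unfolded A_def] nz])
    have "- (1 / \<tau>) * (\<delta> k \<bullet> D k) = (U n (k + 1) - U n k) \<bullet>
        ((1 / 2) *\<^sub>R (L_stab L \<kappa> *v (U n k + U n (k + 1))) - g_stab g \<kappa> (U n k))"
      using tau unfolding D by (simp add: \<delta>_def stage_diff_def inner_diff_right)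
    then show ?thesis
      using energy_step_le[OF L_sym G_gradient g_lipschitz kappa, of "U n (k + 1)" "U n k"] by simp
  qed
  have "energy L G (U n (j + 1)) - energy L G (U n 1)
      = (\<Sum>k = 1..j. energy L G (U n (k + 1)) - energy L G (U n k))"
    by (induction j) simp_all
  also have "\<dots> \<le> (\<Sum>k = 1..j. - (1 / \<tau>) * (\<delta> k \<bullet> D k))"
    using j by (intro sum_mono step) auto
  finally have le: "energy L G (U n (j + 1)) - energy L G (U n 1)
      \<le> - (1 / \<tau>) * (\<Sum>k = 1..j. \<delta> k \<bullet> D k)"
    by (simp only: sum_distrib_left)
  let ?h = "\<lambda>v i. (transpose P *v v) $ i"
  \<comment> \<open>In eigencoordinates the sum splits into one scalar quadratic form for each
    eigenvalue \<open>d i < 0\<close>.\<close>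
  have "(\<Sum>k = 1..j. \<delta> k \<bullet> D k) = (\<Sum>k = 1..j. (transpose P *v \<delta> k) \<bullet> (transpose P *v D k))"
    by (simp only: inner_transpose_orthogonal[OF P])
  also have "\<dots> = (\<Sum>k = 1..j. \<Sum>i\<in>UNIV. ?h (\<delta> k) i * ?h (D k) i)"
    by (simp only: inner_vec_def inner_real_def)
  also have "\<dots> = (\<Sum>i\<in>UNIV. \<Sum>k = 1..j. ?h (\<delta> k) i * ?h (D k) i)"
    by (rule sum.swap)
  also have "\<dots> = (\<Sum>i\<in>UNIV. \<Sum>k = 1..j. ?h (\<delta> k) i *
      (\<Sum>l = 1..k. diff_matrix ?a k l (d i) * ?h (\<delta> l) i))"
    unfolding D_def
    by (simp add: linear_sum[OF matrix_vector_mul_linear] transpose_mat_fun_mult_vec[OF P A]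
        del: transpose_matrix_vector)
  also have "\<dots> \<ge> 0"
    using j by (intro sum_nonneg eerk32_diff_matrix_nonneg neg) auto
  finally have "- (1 / \<tau>) * (\<Sum>k = 1..j. \<delta> k \<bullet> D k) \<le> 0"
    using tau by simp
  with le show ?thesis
    unfolding Let_def D_def \<delta>_def A_def by blast
qed

end
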